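(* There is an absolute constant $\epsilon_0>0$ such that the following holds. Let $t\ge 2$, $\epsilon\in(0,\epsilon_0)$, and let $d\ge 10\epsilon t$ be an integer. Let $(c_{v,\epsilon,t})_{v\ge 0}$ be the coefficients of the Chebyshev expansion \[(1-\epsilon x)^{-t}=\sum_{v=0}^{\infty}2^{v-1}Q_v(x)\,c_{v,\epsilon,t},\qquad x\in[-1,1],\] and let $P(x)=\sum_{v=0}^{d}2^{v-1}Q_v(x)\,c_{v,\epsilon,t}$ be the polynomial formed by its first $d+1$ terms. Then \begin{itemize} \item $\max_{v\le d}|c_{v,\epsilon,t}|\le 2^{O(\epsilon t)}$, and \item $\sup_{x\in[-1,1]}|P(x)-(1-\epsilon x)^{-t}|=O(d\,e^{-d})$, \end{itemize} with absolute constants in the $O(\cdot)$ notation.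
   Context: For an integer $d\ge 0$, the degree-$d$ monic Chebyshev polynomial $Q_d$ is defined by $Q_d(x)=2^{1-d}\cos(d\theta)$ when $x=\cos\theta$. Thus $2^{v-1}Q_v(x)=\cos(v\arccos x)$ is the standard Chebyshev polynomial of the first kind, and the coefficients $c_{v,\epsilon,t}$ are the (absolutely convergent) Chebyshev coefficients of $x\mapsto(1-\epsilon x)^{-t}$ on $[-1,1]$. *)

theory Defs
  imports "HOL-Analysis.Analysis" "HOL-Computational_Algebra.Polynomial"
begin

(* The normalisation 2^(1-d) gives Q_0 = 2, so that 2^(v-1) Q_v is the Chebyshev
   polynomial of the first kind T_v for every v, including T_0 = 1. The polynomial
   Q_d is therefore monic for d > 0 only. *)
definition chebyshev_Q :: "nat \<Rightarrow> real poly" where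
  "chebyshev_Q d =
     (THE p. \<forall>\<theta>. poly p (cos \<theta>) = 2 powi (1 - int d) * cos (real d * \<theta>))"

lemma poly_eq_if_eq_at_cos:
  fixes p q :: "real poly"
  assumes "\<And>\<theta>. poly p (cos \<theta>) = poly q (cos \<theta>)"
  shows "p = q"
proof -
  have "poly (p - q) x = 0" if "x \<in> {-1..1}" for x
    using assms[of "arccos x"] that by simp
  hence "{-1..1} \<subseteq> {x. poly (p - q) x = 0}" by blast
  moreover have "infinite {-1..1::real}" by simp
  ultimately have "infinite {x. poly (p - q) x = 0}" using finite_subset by blast
  hence "p - q = 0" using poly_roots_finite by blast
  thus ?thesis by simp
qed

lemma chebyshev_Q_exists:
  "\<exists>p :: real poly. (\<forall>\<theta>. poly p (cos \<theta>) = 2 powi (1 - int d) * cos (real d * \<theta>)) \<and>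
     (d > 0 \<longrightarrow> degree p = d \<and> lead_coeff p = 1)"
proof (induction d rule: less_induct)
  case (less d)
  consider "d = 0" | "d = 1" | "d = 2" | n where "d = Suc (Suc n)" "n > 0"
    by (metis One_nat_def Suc_1 gr0I not0_implies_Suc)
  thus ?case
  proof cases
    case 1
    thus ?thesis by (intro exI[of _ "[:2:]"]) simp
  next
    case 2
    thus ?thesis by (intro exI[of _ "[:0, 1:]"]) simp
  next
    case 3
    have "2 * (cos \<theta> * cos \<theta>) = 1 + cos (2 * \<theta>)" for \<theta> :: real
      by (simp add: cos_double_cos power2_eq_square)
    thus ?thesis using 3
      by (intro exI[of _ "[:-(1/2), 0, 1:]"]) (simp add: power_int_minus field_simps)
  next
    case 4
    obtain p where p: "\<And>\<theta>. poly p (cos \<theta>) = 2 powi (1 - int n) * cos (real n * \<theta>)"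
        "degree p = n" "lead_coeff p = (1::real)"
      using less.IH[of n] 4 by auto
    obtain q where q: "\<And>\<theta>. poly q (cos \<theta>) = 2 powi (1 - int (Suc n)) * cos (real (Suc n) * \<theta>)"
        "degree q = Suc n" "lead_coeff q = (1::real)"
      using less.IH[of "Suc n"] 4 zero_less_Suc[of n] by (metis lessI)
    define r where "r = pCons 0 q - smult (1/4) p"
    have "q \<noteq> 0" using q by auto
    have deg: "degree (pCons 0 q) = d" using q \<open>q \<noteq> 0\<close> 4 by simp
    have lt: "degree (- smult (1/4) p) < degree (pCons 0 q)" using deg p 4 by simp
    have r': "r = pCons 0 q + (- smult (1/4) p)" by (simp add: r_def)
    have dr: "degree r = d" unfolding r' using degree_add_eq_left[OF lt] deg by simp
    have "coeff r d = 1"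
      using q p 4 by (simp add: r_def coeff_eq_0)
    moreover have "poly r (cos \<theta>) = 2 powi (1 - int d) * cos (real d * \<theta>)" for \<theta>
    proof -
      have e: "2 powi (1 - int n) = 4 * (2 powi (1 - int d) :: real)"
        "2 powi (1 - int (Suc n)) = 2 * (2 powi (1 - int d) :: real)"
        using 4 power_int_add[of "2::real" 2 "1 - int d"] power_int_add[of "2::real" 1 "1 - int d"]
        by (simp_all add: algebra_simps)
      have c: "cos (real d * \<theta>) = 2 * cos \<theta> * cos (real (Suc n) * \<theta>) - cos (real n * \<theta>)"
      proof -
        have "real d * \<theta> = real (Suc n) * \<theta> + \<theta>" "real n * \<theta> = real (Suc n) * \<theta> - \<theta>"
          using 4 by (simp_all add: algebra_simps)
        thus ?thesis by (simp only: cos_add cos_diff) simp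
      qed
      show ?thesis
        unfolding r_def c by (simp add: p(1) q(1) e del: of_nat_Suc) (simp add: algebra_simps)
    qed
    ultimately show ?thesis using dr by blast
  qed
qed

lemma chebyshev_Q_unique:
  "\<exists>!p :: real poly. \<forall>\<theta>. poly p (cos \<theta>) = 2 powi (1 - int d) * cos (real d * \<theta>)"
  using chebyshev_Q_exists[of d] poly_eq_if_eq_at_cos by (metis (no_types, lifting))

lemma poly_chebyshev_Q_cos:
  "poly (chebyshev_Q d) (cos \<theta>) = 2 powi (1 - int d) * cos (real d * \<theta>)"
  using theI'[OF chebyshev_Q_unique[of d]] unfolding chebyshev_Q_def by blast

lemma chebyshev_Q_monic:
  assumes "d > 0"
  shows "degree (chebyshev_Q d) = d" "lead_coeff (chebyshev_Q d) = 1"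
proof -
  obtain p :: "real poly" where
    p: "\<And>\<theta>. poly p (cos \<theta>) = 2 powi (1 - int d) * cos (real d * \<theta>)"
      "degree p = d" "lead_coeff p = 1"
    using chebyshev_Q_exists[of d] assms by auto
  have "chebyshev_Q d = p"
    by (rule poly_eq_if_eq_at_cos) (simp add: p(1) poly_chebyshev_Q_cos)
  thus "degree (chebyshev_Q d) = d" "lead_coeff (chebyshev_Q d) = 1" using p by auto
qed

(* Since |2^(v-1) Q_v| <= 1 on [-1,1] with equality at 1, absolute convergence of the
   expansion on [-1,1] amounts to absolute summability of the coefficients. *)
definition chebyshev_expansion :: "(real \<Rightarrow> real) \<Rightarrow> (nat \<Rightarrow> real) \<Rightarrow> bool" where
  "chebyshev_expansion f c \<longleftrightarrow>
     summable (\<lambda>v. \<bar>c v\<bar>) \<and>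
     (\<forall>x\<in>{-1..1}. (\<lambda>v. 2 powi (int v - 1) * poly (chebyshev_Q v) x * c v) sums f x)"

definition chebyshev_truncation :: "(nat \<Rightarrow> real) \<Rightarrow> nat \<Rightarrow> real poly" where
  "chebyshev_truncation c d =
     (\<Sum>v\<le>d. smult (2 powi (int v - 1) * c v) (chebyshev_Q v))"

end

(* The binomial series of (1 - \<epsilon> x)^(-t) has nonnegative coefficients a_n, and x^n is a convex
   combination of T_0, ..., T_n. Hence the Chebyshev coefficients are nonnegative and at most
   f(1) = (1 - \<epsilon>)^(-t). Truncation at degree d does not affect the monomials of degree at most d
   and changes every other one by at most 1 in absolute value, so the error is at most
   \<Sum>_{n>d} a_n \<le> r^(-d) f(r). For r = e^2 we have f(r) \<le> exp (10 \<epsilon> t) \<le> e^d, which makes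
   this at most e^(-d). *)
theory Submission
  imports Defs
begin

section \<open>Powers of cosine as combinations of cosines of multiples\<close>

lemma chebyshev_term_cos:
  "2 powi (int v - 1) * poly (chebyshev_Q v) (cos \<theta>) = cos (real v * \<theta>)"
  by (simp add: poly_chebyshev_Q_cos flip: mult.assoc power_int_add)

text \<open>The product formula cos \<theta> cos(v\<theta>) = (cos((v+1)\<theta>) +
  cos((v-1)\<theta>))/2 has nonnegative weights, so multiplying by cos \<theta> preserves
  nonnegativity.\<close>

lemma cos_power_cosine_expansion:
  "\<exists>b :: nat \<Rightarrow> real. (\<forall>v. 0 \<le> b v) \<and>
     (\<forall>\<theta>. cos \<theta> ^ n = (\<Sum>v\<le>n. b v * cos (real v * \<theta>)))"
proof (induction n)
  case 0
  show ?case by (intro exI[of _ "\<lambda>_. 1"]) simp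
next
  case (Suc n)
  then obtain b :: "nat \<Rightarrow> real" where b: "\<And>v. 0 \<le> b v"
    "\<And>\<theta>. cos \<theta> ^ n = (\<Sum>v\<le>n. b v * cos (real v * \<theta>))" by blast
  \<comment> \<open>\<open>p v\<close> is |v - 1|: as cosine is even, frequency -1 is reflected to
    1, which keeps the frequencies in the naturals.\<close>
  define p where "p v = (if v = 0 then 1 else v - 1)" for v :: nat
  \<comment> \<open>Each old weight \<open>b v\<close> is split into halves sent to
    \<open>Suc v\<close> and \<open>p v\<close>. The two indicators are added rather than joined by
    a disjunction, because for v = 0 both halves land on 1.\<close>
  define b' where "b' u = (\<Sum>v\<le>n. b v / 2 * (of_bool (u = Suc v) + of_bool (u = p v)))" for u
  have p_le: "p v \<le> Suc n" if "v \<le> n" for v using that by (auto simp: p_def)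
  have step: "cos \<theta> * cos (real v * \<theta>) = (cos (real (Suc v) * \<theta>) + cos (real (p v) * \<theta>)) / 2"
    for v and \<theta> :: real
  proof (cases v)
    case (Suc k)
    have "cos (real (Suc v) * \<theta>) = cos (real v * \<theta> + \<theta>)" "cos (real (p v) * \<theta>) = cos (real v * \<theta> - \<theta>)"
      by (simp_all add: p_def Suc algebra_simps)
    thus ?thesis by (simp add: cos_add cos_diff)
  qed (simp add: p_def)
  have "cos \<theta> ^ Suc n = (\<Sum>v\<le>Suc n. b' v * cos (real v * \<theta>))" for \<theta>
  proof -
    have "(\<Sum>u\<le>Suc n. b' u * cos (real u * \<theta>)) =
        (\<Sum>v\<le>n. \<Sum>u\<le>Suc n. b v / 2 * (of_bool (u = Suc v) + of_bool (u = p v)) * cos (real u * \<theta>))"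
      unfolding b'_def sum_distrib_right by (rule sum.swap)
    also have "\<dots> = (\<Sum>v\<le>n. b v * (cos \<theta> * cos (real v * \<theta>)))"
    proof (rule sum.cong[OF refl])
      fix v assume v: "v \<in> {..n}"
      have "(\<Sum>u\<le>Suc n. b v / 2 * (of_bool (u = Suc v) + of_bool (u = p v)) * cos (real u * \<theta>)) =
          (\<Sum>u\<le>Suc n. if u = Suc v then b v / 2 * cos (real u * \<theta>) else 0) +
          (\<Sum>u\<le>Suc n. if u = p v then b v / 2 * cos (real u * \<theta>) else 0)"
        unfolding sum.distrib[symmetric] by (rule sum.cong) (auto simp: algebra_simps)
      also have "\<dots> = b v * (cos \<theta> * cos (real v * \<theta>))"
        using v p_le[of v] unfolding step by (simp add: sum.delta field_simps del: sum.atMost_Suc of_nat_Suc)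
      finally show "(\<Sum>u\<le>Suc n. b v / 2 * (of_bool (u = Suc v) + of_bool (u = p v)) * cos (real u * \<theta>)) =
          b v * (cos \<theta> * cos (real v * \<theta>))" .
    qed
    also have "\<dots> = cos \<theta> ^ Suc n"
      by (simp add: b(2) sum_distrib_left mult_ac)
    finally show ?thesis ..
  qed
  moreover have "0 \<le> b' u" for u unfolding b'_def by (intro sum_nonneg mult_nonneg_nonneg) (auto simp: b)
  ultimately show ?case by blast
qed

section \<open>Orthogonality of cosines and uniqueness of the expansion\<close>

lemma has_integral_cos_int_mult:
  "((\<lambda>\<theta>. cos (of_int k * \<theta>)) has_integral (if k = 0 then pi else 0)) {0..pi}"
proof (cases "k = 0")
  case True
  thus ?thesis using has_integral_const_real[of "1::real" 0 pi] by simp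
next
  case False
  have "((\<lambda>\<theta>. cos (of_int k * \<theta>)) has_integral
      (sin (of_int k * pi) / of_int k - sin (of_int k * 0) / of_int k)) {0..pi}"
    using False
    by (intro fundamental_theorem_of_calculus)
       (auto intro!: derivative_eq_intros simp flip: has_real_derivative_iff_has_vector_derivative)
  moreover have "sin (of_int k * pi) = 0" using sin_npi_int[of k] by (simp add: mult.commute)
  ultimately show ?thesis using False by simp
qed

text \<open>The product is half the sum of the cosines of frequencies v - m and v + m, taken as
  integers since the difference may be negative. Each integrates to zero unless its frequency
  vanishes; both vanish exactly when v = m = 0, which doubles the value.\<close>

lemma has_integral_cos_mult_cos:
  fixes v m :: nat
  shows "((\<lambda>\<theta>. cos (real v * \<theta>) * cos (real m * \<theta>)) has_integral
     (of_bool (v = m) + of_bool (v + m = 0)) * pi / 2) {0..pi}"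
proof -
  have "((\<lambda>\<theta>. (cos (of_int (int v - int m) * \<theta>) + cos (of_int (int v + int m) * \<theta>)) * (1/2)) has_integral
     ((if int v - int m = 0 then pi else 0) + (if int v + int m = 0 then pi else 0)) * (1/2)) {0..pi}"
    by (intro has_integral_mult_left has_integral_add has_integral_cos_int_mult)
  moreover have "(cos (of_int (int v - int m) * \<theta>) + cos (of_int (int v + int m) * \<theta>)) * (1/2) =
      cos (real v * \<theta>) * cos (real m * \<theta>)" for \<theta> :: real
    by (simp add: algebra_simps cos_add cos_diff)
  moreover have "((if int v - int m = 0 then pi else 0) + (if int v + int m = 0 then pi else 0)) * (1/2) =
      (of_bool (v = m) + of_bool (v + m = 0)) * pi / 2" by auto
  ultimately show ?thesis by (simp only:)
qed

text \<open>Fourier's extraction of a coefficient: multiply by cos(m\<theta>) and integrate over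
  [0, \<pi>]. Absolute summability gives uniform convergence by the M-test, so the limit passes
  through the integral.\<close>

lemma cosine_series_zero_imp_coeffs_zero:
  fixes e :: "nat \<Rightarrow> real" and m :: nat
  assumes summable: "summable (\<lambda>v. \<bar>e v\<bar>)"
    and zero: "\<And>\<theta>. (\<lambda>v. e v * cos (real v * \<theta>)) sums 0"
  shows "e m = 0"
proof -
  define S where "S N \<theta> = (\<Sum>v<N. e v * cos (real v * \<theta>) * cos (real m * \<theta>))" for N and \<theta> :: real
  have "uniform_limit (cbox 0 pi) S (\<lambda>\<theta>. \<Sum>v. e v * cos (real v * \<theta>) * cos (real m * \<theta>)) sequentially"
    unfolding S_def
  proof (rule Weierstrass_m_test[OF _ summable])
    fix v and \<theta> :: real
    show "norm (e v * cos (real v * \<theta>) * cos (real m * \<theta>)) \<le> \<bar>e v\<bar>"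
      by (simp add: abs_mult mult_left_le mult_le_one mult.assoc)
  qed
  moreover have "(\<Sum>v. e v * cos (real v * \<theta>) * cos (real m * \<theta>)) = 0" for \<theta>
    using sums_mult2[OF zero[of \<theta>], of "cos (real m * \<theta>)"] by (simp add: sums_iff)
  ultimately have "uniform_limit (cbox 0 pi) S (\<lambda>_. 0) sequentially" by simp
  moreover have "continuous_on (cbox 0 pi) (S N)" for N
    unfolding S_def by (intro continuous_intros)
  ultimately obtain I J where IJ: "\<And>N. (S N has_integral I N) (cbox 0 pi)"
    "((\<lambda>_. 0::real) has_integral J) (cbox 0 (pi::real))" "I \<longlonglongrightarrow> J"
    using uniform_limit_integral_cbox[where a = 0 and b = pi and f = S and g = "\<lambda>_. 0" and F = sequentially] by auto
  have "J = 0" using IJ(2) has_integral_0 has_integral_unique by blast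
  \<comment> \<open>The integral of cos(m\<theta>)^2 over [0, \<pi>].\<close>
  define K where "K = (1 + of_bool (m = 0)) * pi / 2"
  \<comment> \<open>Once the partial sum includes index m, orthogonality leaves only that term, so
    the integrals are eventually constant.\<close>
  have "I N = e m * K" if "N > m" for N
  proof -
    have "(S N has_integral (\<Sum>v<N. e v * ((of_bool (v = m) + of_bool (v + m = 0)) * pi / 2))) {0..pi}"
      unfolding S_def mult.assoc
      using has_integral_cos_mult_cos
      by (intro has_integral_sum has_integral_mult_right) (auto simp: mult.assoc)
    moreover have "(\<Sum>v<N. e v * ((of_bool (v = m) + of_bool (v + m = 0)) * pi / 2)) =
        (\<Sum>v<N. if v = m then e v * K else 0)"
      by (rule sum.cong) (auto simp: K_def)
    ultimately have "(S N has_integral e m * K) {0..pi}" using that by simp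
    thus ?thesis using IJ(1)[of N] has_integral_unique by (metis box_real(2))
  qed
  hence "eventually (\<lambda>N. I N = e m * K) sequentially"
    using eventually_gt_at_top[of m] by (rule eventually_mono[rotated])
  hence "I \<longlonglongrightarrow> e m * K" by (rule tendsto_eventually)
  hence "e m * K = 0" using IJ(3) \<open>J = 0\<close> LIMSEQ_unique by blast
  moreover have "K > 0" by (simp add: K_def)
  ultimately show ?thesis by simp
qed

text \<open>The substitution x = cos \<theta> maps onto [-1,1], which turns a Chebyshev expansion
  into a cosine series; all later arguments use this form.\<close>

lemma chebyshev_expansion_cos:
  "chebyshev_expansion f c \<longleftrightarrow> summable (\<lambda>v. \<bar>c v\<bar>) \<and>
     (\<forall>\<theta>. (\<lambda>v. c v * cos (real v * \<theta>)) sums f (cos \<theta>))"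
proof -
  have "(\<forall>x\<in>{-1..1}. P x) \<longleftrightarrow> (\<forall>\<theta>. P (cos \<theta>))" for P :: "real \<Rightarrow> bool"
    by (metis atLeastAtMost_iff cos_arccos cos_ge_minus_one cos_le_one)
  thus ?thesis
    unfolding chebyshev_expansion_def by (simp only: chebyshev_term_cos mult.commute[of "cos _"])
qed

lemma chebyshev_expansion_unique:
  assumes "chebyshev_expansion f c" "chebyshev_expansion f c'"
  shows "c = c'"
proof
  fix m
  have "summable (\<lambda>v. \<bar>c v - c' v\<bar>)"
  proof (rule summable_comparison_test')
    show "summable (\<lambda>v. \<bar>c v\<bar> + \<bar>c' v\<bar>)"
      using assms unfolding chebyshev_expansion_def by (intro summable_add) auto
  qed (simp add: abs_triangle_ineq4)
  moreover have "(\<lambda>v. (c v - c' v) * cos (real v * \<theta>)) sums 0" for \<theta>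
    using sums_diff[of "\<lambda>v. c v * cos (real v * \<theta>)" "f (cos \<theta>)" "\<lambda>v. c' v * cos (real v * \<theta>)" "f (cos \<theta>)"]
      assms unfolding chebyshev_expansion_cos by (simp add: left_diff_distrib)
  ultimately show "c m = c' m"
    using cosine_series_zero_imp_coeffs_zero[of "\<lambda>v. c v - c' v" m] by simp
qed

section \<open>Chebyshev expansion of a power series with nonnegative coefficients\<close>

lemma poly_chebyshev_truncation_cos:
  "poly (chebyshev_truncation c d) (cos \<theta>) = (\<Sum>v\<le>d. c v * cos (real v * \<theta>))"
  unfolding chebyshev_truncation_def poly_sum poly_smult chebyshev_term_cos[symmetric]
  by (simp only: mult_ac)

text \<open>Expand every power of cos \<theta> and collect frequency v over all n to get
  \<open>c v\<close>. Only finite sums over v are exchanged with the infinite sum over n;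
  convergence of the expansion then follows from the truncation bound itself.\<close>

theorem chebyshev_expansion_of_nonneg_power_series:
  fixes a :: "nat \<Rightarrow> real"
  assumes nonneg: "\<And>n. 0 \<le> a n"
    and series: "\<And>x. \<lbrakk>-1 \<le> x; x \<le> 1\<rbrakk> \<Longrightarrow> (\<lambda>n. a n * x ^ n) sums f x"
  obtains c where "chebyshev_expansion f c"
    "\<And>v. 0 \<le> c v" "\<And>v. c v \<le> f 1"
    "\<And>d \<theta>. \<bar>(\<Sum>v\<le>d. c v * cos (real v * \<theta>)) - f (cos \<theta>)\<bar> \<le> (\<Sum>n. a (n + Suc d))"
proof -
  obtain b :: "nat \<Rightarrow> nat \<Rightarrow> real" where b: "\<And>n v. 0 \<le> b n v"
    "\<And>n \<theta>. cos \<theta> ^ n = (\<Sum>v\<le>n. b n v * cos (real v * \<theta>))"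
    using cos_power_cosine_expansion by metis
  \<comment> \<open>Extension by zero beyond v = n lets the expansion of the n-th power be summed up
    to any N \<ge> n.\<close>
  define \<beta> where "\<beta> n v = (if v \<le> n then b n v else 0)" for n v
  have \<beta>_nonneg: "0 \<le> \<beta> n v" for n v by (simp add: \<beta>_def b)
  have \<beta>_cos: "cos \<theta> ^ n = (\<Sum>v\<le>N. \<beta> n v * cos (real v * \<theta>))" if "n \<le> N" for n N \<theta>
    unfolding b(2) \<beta>_def using that by (intro sum.mono_neutral_cong_left) auto
  \<comment> \<open>At \<theta> = 0 every cosine equals 1.\<close>
  have \<beta>_sum: "(\<Sum>v\<le>n. \<beta> n v) = 1" for n using \<beta>_cos[of n n 0] by simp
  have \<beta>_le: "\<beta> n v \<le> 1" for n v
  proof (cases "v \<le> n")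
    case True
    thus ?thesis using \<beta>_sum[of n] member_le_sum[of v "{..n}" "\<beta> n"] \<beta>_nonneg by simp
  qed (simp add: \<beta>_def)
  have a_sums: "a sums f 1" using series[of 1] by simp
  hence a_summable: "summable a" by (rule sums_summable)
  define c where "c v = (\<Sum>n. a n * \<beta> n v)" for v
  have summ: "summable (\<lambda>n. a n * \<beta> n v)" for v
    by (rule summable_comparison_test'[OF a_summable, of 0])
       (simp add: abs_mult nonneg \<beta>_nonneg \<beta>_le mult_left_le)
  have c_nonneg: "0 \<le> c v" for v
    unfolding c_def by (intro suminf_nonneg summ mult_nonneg_nonneg nonneg \<beta>_nonneg)
  have c_le: "c v \<le> f 1" for v
    using suminf_le[OF _ summ a_summable, of v] a_sums
    by (simp add: c_def sums_iff nonneg \<beta>_le mult_left_le)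
  have err: "\<bar>(\<Sum>v\<le>d. c v * cos (real v * \<theta>)) - f (cos \<theta>)\<bar> \<le> (\<Sum>n. a (n + Suc d))" for d \<theta>
  proof -
    \<comment> \<open>The error of truncating the n-th power alone; the total error is the sum of
      these, weighted by \<open>a n\<close>.\<close>
    define R where "R n = (\<Sum>v\<le>d. \<beta> n v * cos (real v * \<theta>)) - cos \<theta> ^ n" for n
    have R0: "R n = 0" if "n \<le> d" for n using \<beta>_cos[OF that, of \<theta>] by (simp add: R_def)
    \<comment> \<open>What is lost are the frequencies in \<open>{d<..n}\<close>, whose nonnegative
      weights total at most 1.\<close>
    have R1: "\<bar>R n\<bar> \<le> 1" if "d < n" for n
    proof -
      have "R n = - (\<Sum>v\<in>{d<..n}. \<beta> n v * cos (real v * \<theta>))"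
      proof -
        have "{..n} = {..d} \<union> {d<..n}" using that by auto
        thus ?thesis unfolding R_def \<beta>_cos[of n n, OF order_refl]
          by (simp add: sum.union_disjoint ivl_disj_int)
      qed
      hence "\<bar>R n\<bar> \<le> (\<Sum>v\<in>{d<..n}. \<bar>\<beta> n v * cos (real v * \<theta>)\<bar>)" by simp
      also have "\<dots> \<le> (\<Sum>v\<in>{d<..n}. \<beta> n v)"
        by (intro sum_mono) (simp add: abs_mult \<beta>_nonneg mult_left_le)
      also have "\<dots> \<le> (\<Sum>v\<le>n. \<beta> n v)" by (intro sum_mono2) (auto simp: \<beta>_nonneg)
      finally show ?thesis by (simp add: \<beta>_sum)
    qed
    have "(\<lambda>n. \<Sum>v\<le>d. a n * \<beta> n v * cos (real v * \<theta>)) sums (\<Sum>v\<le>d. c v * cos (real v * \<theta>))"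
      unfolding c_def by (intro sums_sum sums_mult2 summable_sums summ)
    from sums_diff[OF this series[of "cos \<theta>"]]
    have sums_R: "(\<lambda>n. a n * R n) sums ((\<Sum>v\<le>d. c v * cos (real v * \<theta>)) - f (cos \<theta>))"
      by (simp add: R_def sum_distrib_left algebra_simps)
    have "(\<lambda>n. a (n + Suc d) * R (n + Suc d)) sums ((\<Sum>v\<le>d. c v * cos (real v * \<theta>)) - f (cos \<theta>))"
      using sums_R R0 sums_iff_shift[of "\<lambda>n. a n * R n" "Suc d"] by simp
    moreover have "\<bar>\<Sum>n. a (n + Suc d) * R (n + Suc d)\<bar> \<le> (\<Sum>n. a (n + Suc d))"
      using R1 nonneg a_summable unfolding real_norm_def[symmetric]
      by (intro norm_suminf_le) (auto simp: abs_mult mult_left_le summable_iff_shift simp del: add_Suc_right)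
    ultimately show ?thesis by (simp add: sums_iff)
  qed
  have sums_c: "(\<lambda>v. c v * cos (real v * \<theta>)) sums f (cos \<theta>)" for \<theta>
  proof -
    \<comment> \<open>Tails of the convergent series of \<open>a\<close> tend to 0, and
      \<open>err\<close> carries this over to the truncations.\<close>
    have "(\<lambda>d. \<Sum>n. a (n + Suc d)) \<longlonglongrightarrow> 0"
      using suminf_exist_split2[OF a_summable] LIMSEQ_Suc by blast
    hence "(\<lambda>d. (\<Sum>v\<le>d. c v * cos (real v * \<theta>)) - f (cos \<theta>)) \<longlonglongrightarrow> 0"
      by (rule Lim_null_comparison[rotated]) (use err in auto)
    thus ?thesis unfolding sums_def_le using LIM_zero_iff by blast
  qed
  have "chebyshev_expansion f c"
    \<comment> \<open>Convergence at \<theta> = 0 is summability of \<open>c\<close>, which is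
      absolute because \<open>c\<close> is nonnegative.\<close>
    unfolding chebyshev_expansion_cos using sums_c sums_c[of 0] c_nonneg by (auto simp: sums_iff)
  thus thesis using that c_nonneg c_le err by blast
qed

section \<open>The function (1 - \<epsilon> x)^(-t): series, growth, tail and final bounds\<close>

lemma binomial_series_negative_exponent:
  fixes t \<epsilon> :: real
  assumes "0 \<le> t" "0 \<le> \<epsilon>"
  obtains a where "\<And>n. 0 \<le> a n"
    "\<And>x. \<bar>\<epsilon> * x\<bar> < 1 \<Longrightarrow> (\<lambda>n. a n * x ^ n) sums ((1 - \<epsilon> * x) powr (- t))"
proof
  show "0 \<le> ((- t) gchoose n) * (- \<epsilon>) ^ n" for n
  proof -
    \<comment> \<open>Negating the upper index yields a factor (-1)^n, which cancels the sign of
      \<open>(- \<epsilon>) ^ n\<close>.\<close>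
    have "((- t) gchoose n) * (- \<epsilon>) ^ n = ((real n + t - 1) gchoose n) * \<epsilon> ^ n"
      by (subst gbinomial_negated_upper) (simp add: power_minus[of \<epsilon>])
    moreover have "0 \<le> (real n + t - 1) gchoose n"
      \<comment> \<open>The factors are n + t - 1 - i with i < n, hence at least t.\<close>
      unfolding gbinomial_prod_rev using assms by (intro divide_nonneg_nonneg prod_nonneg) auto
    ultimately show ?thesis using assms by simp
  qed
  show "(\<lambda>n. ((- t) gchoose n) * (- \<epsilon>) ^ n * x ^ n) sums ((1 - \<epsilon> * x) powr (- t))"
    if "\<bar>\<epsilon> * x\<bar> < 1" for x
    using gen_binomial_real[of "- (\<epsilon> * x)" "- t"] that
    by (simp add: mult.assoc flip: power_mult_distrib)
qed

text \<open>This is ln z \<le> z - 1 at z = 1/(1 - y). It is applied with y = \<epsilon> for the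
  coefficients and y = \<epsilon> e^2 for the tail.\<close>

lemma one_minus_powr_minus_le_exp:
  fixes y t :: real
  assumes "y < 1" "0 \<le> t"
  shows "(1 - y) powr (- t) \<le> exp (t * (y / (1 - y)))"
proof -
  have "- ln (1 - y) = ln (1 / (1 - y))" using assms by (simp add: ln_div)
  also have "\<dots> \<le> 1 / (1 - y) - 1" using assms by (intro ln_le_minus_one) auto
  also have "\<dots> = y / (1 - y)" using assms by (simp add: field_simps)
  finally show ?thesis using assms mult_left_mono[of "- ln (1 - y)" "y / (1 - y)" t]
    by (simp add: powr_def)
qed

text \<open>For every index n + m of the tail, r^(n+m) / r^m \<ge> 1; inserting this factor and then
  restoring the nonnegative initial terms gives the bound.\<close>

lemma nonneg_power_series_tail_le:
  fixes a :: "nat \<Rightarrow> real"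
  assumes "\<And>n. 0 \<le> a n" "(\<lambda>n. a n * r ^ n) sums s" "1 \<le> r"
  shows "(\<Sum>n. a (n + m)) \<le> s / r ^ m"
proof -
  have term_le: "a (n + m) \<le> a (n + m) * r ^ (n + m) / r ^ m" for n
    using mult_left_mono[OF one_le_power[OF assms(3), of n] assms(1)[of "n + m"]] assms(3)
    by (simp add: power_add)
  have summable_r: "summable (\<lambda>n. a (n + m) * r ^ (n + m))"
    using assms(2) sums_summable summable_iff_shift[of "\<lambda>n. a n * r ^ n" m] by blast
  have summable_a: "summable (\<lambda>n. a (n + m))"
    by (rule summable_comparison_test'[OF summable_divide[OF summable_r, of "r ^ m"], of 0])
       (use term_le assms(1) in simp)
  have "(\<Sum>n. a (n + m)) \<le> (\<Sum>n. a (n + m) * r ^ (n + m) / r ^ m)"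
    by (intro suminf_le term_le summable_a summable_divide summable_r)
  also have "\<dots> = (\<Sum>n. a (n + m) * r ^ (n + m)) / r ^ m"
    by (rule suminf_divide[OF summable_r])
  also have "(\<Sum>n. a (n + m) * r ^ (n + m)) \<le> s"
    using assms suminf_split_initial_segment[of "\<lambda>n. a n * r ^ n" m]
    by (simp add: sums_iff sum_nonneg)
  finally show ?thesis using assms(3) by (simp add: divide_right_mono)
qed

text \<open>The constants are quantified before t, \<epsilon> and d, hence absolute. Unique
  existence of \<open>c\<close> keeps the bounds from holding vacuously, and
  \<open>\<epsilon>\<^sub>0 \<le> 1\<close> keeps the base of \<open>powr\<close> positive on
  [-1,1].\<close>

theorem mainTheorem4:
  "\<exists>\<epsilon>\<^sub>0 C\<^sub>1 C\<^sub>2 :: real. 0 < \<epsilon>\<^sub>0 \<and> \<epsilon>\<^sub>0 \<le> 1 \<and>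
     (\<forall>(t :: real) (\<epsilon> :: real) (d :: nat).
        2 \<le> t \<longrightarrow> 0 < \<epsilon> \<longrightarrow> \<epsilon> < \<epsilon>\<^sub>0 \<longrightarrow> 10 * \<epsilon> * t \<le> real d \<longrightarrow>
        (\<exists>!c. chebyshev_expansion (\<lambda>x. (1 - \<epsilon> * x) powr (- t)) c) \<and>
        (\<forall>c. chebyshev_expansion (\<lambda>x. (1 - \<epsilon> * x) powr (- t)) c \<longrightarrow>
           Max ((\<lambda>v. \<bar>c v\<bar>) ` {..d}) \<le> 2 powr (C\<^sub>1 * (\<epsilon> * t)) \<and>
           (SUP x\<in>{-1..1}. \<bar>poly (chebyshev_truncation c d) x - (1 - \<epsilon> * x) powr (- t)\<bar>)
             \<le> C\<^sub>2 * (real d * exp (- real d))))"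
\<comment> \<open>The bound 1/100 keeps \<epsilon> e^2 below 0.074, and 2 / ln 2 rewrites
  exp(2\<epsilon>t) as a power of 2.\<close>
proof (rule exI[of _ "1/100"], rule exI[of _ "2 / ln 2"], rule exI[of _ 1], intro conjI allI impI)
  fix t \<epsilon> :: real and d :: nat
  assume t: "2 \<le> t" and \<epsilon>: "0 < \<epsilon>" "\<epsilon> < 1/100" and d: "10 * \<epsilon> * t \<le> real d"
  let ?f = "\<lambda>x. (1 - \<epsilon> * x) powr (- t)"
  obtain a where a: "\<And>n. 0 \<le> a n" "\<And>x. \<bar>\<epsilon> * x\<bar> < 1 \<Longrightarrow> (\<lambda>n. a n * x ^ n) sums ?f x"
    using binomial_series_negative_exponent[of t \<epsilon>] t \<epsilon> by auto
  have "\<bar>\<epsilon> * x\<bar> < 1" if "- 1 \<le> x" "x \<le> 1" for x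
  proof -
    have "\<bar>x\<bar> \<le> 1" using that by linarith
    hence "\<epsilon> * \<bar>x\<bar> \<le> \<epsilon>" using \<epsilon> by simp
    thus ?thesis using \<epsilon> unfolding abs_mult by linarith
  qed
  then obtain c where c: "chebyshev_expansion ?f c" "\<And>v. 0 \<le> c v" "\<And>v. c v \<le> ?f 1"
    "\<And>d \<theta>. \<bar>(\<Sum>v\<le>d. c v * cos (real v * \<theta>)) - ?f (cos \<theta>)\<bar> \<le> (\<Sum>n. a (n + Suc d))"
    using chebyshev_expansion_of_nonneg_power_series[of a ?f] a by blast
  show "\<exists>!c. chebyshev_expansion ?f c" using c(1) chebyshev_expansion_unique by blast
  fix c' assume "chebyshev_expansion ?f c'"
  hence c': "c' = c" using c(1) chebyshev_expansion_unique by blast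
  have "\<epsilon> / (1 - \<epsilon>) \<le> 2 * \<epsilon>" using \<epsilon> by (simp add: field_simps)
  hence "t * (\<epsilon> / (1 - \<epsilon>)) \<le> t * (2 * \<epsilon>)" using t by (intro mult_left_mono) auto
  hence "?f 1 \<le> exp (t * (2 * \<epsilon>))"
    using one_minus_powr_minus_le_exp[of \<epsilon> t] \<epsilon> t by (simp add: order_trans)
  also have "\<dots> = 2 powr (2 / ln 2 * (\<epsilon> * t))" by (simp add: powr_def)
  finally have "c v \<le> 2 powr (2 / ln 2 * (\<epsilon> * t))" for v using c(3)[of v] by linarith
  thus "Max ((\<lambda>v. \<bar>c' v\<bar>) ` {..d}) \<le> 2 powr (2 / ln 2 * (\<epsilon> * t))"
    by (auto simp: c' c(2))
  let ?r = "exp 2 :: real"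
  \<comment> \<open>From e < 2.72 follows e^2 < 7.4, the numerical input for the choice of
    radius.\<close>
  have "?r = exp 1 * exp 1" by (simp flip: exp_add)
  also have "\<dots> \<le> (272/100) * (272/100)" using e_less_272 by (intro mult_mono) auto
  finally have r: "?r \<le> 74/10" by simp
  have er: "\<epsilon> * ?r \<le> 74/10 * \<epsilon>" using r \<epsilon> by simp
  have "0 < \<epsilon> * ?r" using \<epsilon> by simp
  hence er1: "\<bar>\<epsilon> * ?r\<bar> < 1" using er \<epsilon> by linarith
  \<comment> \<open>Since \<epsilon> t > 0, the lower bound on d excludes d = 0.\<close>
  have d_pos: "1 \<le> real d" using d t \<epsilon> by (cases d) (auto simp: mult_le_0_iff)
  \<comment> \<open>Here the 10 of the hypothesis on d arises: e^2 / (1 - \<epsilon> e^2) is at most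
    7.4 / 0.926 < 10.\<close>
  have "\<epsilon> * ?r / (1 - \<epsilon> * ?r) \<le> 10 * \<epsilon>"
  proof -
    have "\<epsilon> * ?r \<le> \<epsilon> * (10 * (1 - \<epsilon> * ?r))"
    proof (rule mult_left_mono)
      show "?r \<le> 10 * (1 - \<epsilon> * ?r)" using r er \<epsilon> by argo
    qed (use \<epsilon> in simp)
    thus ?thesis using er1 by (simp add: pos_divide_le_eq algebra_simps)
  qed
  hence "t * (\<epsilon> * ?r / (1 - \<epsilon> * ?r)) \<le> t * (10 * \<epsilon>)" using t by (intro mult_left_mono) auto
  hence f_r: "?f ?r \<le> exp (real d)"
    using one_minus_powr_minus_le_exp[of "\<epsilon> * ?r" t] er1 t d
    by (smt (verit) exp_le_cancel_iff mult.commute mult.left_commute)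
  have "(\<Sum>n. a (n + Suc d)) \<le> ?f ?r / ?r ^ Suc d"
    using a(1) a(2)[OF er1] by (rule nonneg_power_series_tail_le) simp
  \<comment> \<open>One of the d + 1 factors e^2 is discarded, leaving e^d / e^(2d).\<close>
  also have "\<dots> \<le> exp (real d) / ?r ^ d"
    using f_r by (intro frac_le) auto
  also have "\<dots> = exp (- real d)"
    by (simp flip: exp_of_nat_mult exp_diff)
  also have "\<dots> \<le> real d * exp (- real d)" using d_pos by simp
  finally have tail: "(\<Sum>n. a (n + Suc d)) \<le> real d * exp (- real d)" .
  show "(SUP x\<in>{-1..1}. \<bar>poly (chebyshev_truncation c' d) x - ?f x\<bar>) \<le> 1 * (real d * exp (- real d))"
  \<comment> \<open>A uniform pointwise bound suffices; each x is written as cos(arccos x) to apply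
    the cosine form of the error.\<close>
  proof (rule cSUP_least)
    fix x :: real assume "x \<in> {-1..1}"
    hence "cos (arccos x) = x" by simp
    thus "\<bar>poly (chebyshev_truncation c' d) x - ?f x\<bar> \<le> 1 * (real d * exp (- real d))"
      using c(4)[of "arccos x" d] poly_chebyshev_truncation_cos[of c d "arccos x"] tail c' by simp
  qed simp
qed simp_all

end
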